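(* Assume that for every $g\in L^2(\Omega)$ the problem $-A:D^2 v=g$ in $\Omega$, $v=0$ on $\partial\Omega$, has a unique solution $v\in V$. Let $f\in L^2(\Omega)$, let $(u,\boldsymbol\sigma)\in H_0^1(\Omega)\times Q$ be the minimizer of $\mathcal{J}_h(\cdot,\cdot;f)$ over $H^1_0(\Omega)\times Q$ (so $-A:D^2u=f$ and $\boldsymbol\sigma=\nabla u$), let $k\ge2$, and let $(u_h,\boldsymbol\sigma_h)\in S_{k,0}\times S_{k-1}^d$ be the minimizer of $\mathcal{J}_h(\cdot,\cdot;f)$ over $S_{k,0}\times S_{k-1}^d$ (the weighted-LSFEM solution). Define $$\eta_{h,K}^2=h_K^2\|f+A:\nabla\boldsymbol\sigma_h\|_{0,K}^2+\|\boldsymbol\sigma_h-\nabla u_h\|_{0,K}^2\ (K\in\mathcal{T}),\qquad \eta_h^2=\sum_{K\in\mathcal{T}}\eta_{h,K}^2 .$$ Then $$\eta_h=|||(u-u_h,\boldsymbol\sigma-\boldsymbol\sigma_h)|||_h\quad\text{and}\quad \eta_{h,K}=|||(u-u_h,\boldsymbol\sigma-\boldsymbol\sigma_h)|||_{h,K}\quad\forall K\in\mathcal{T},$$ and there is a constant $C>0$ independent of the mesh size $h$ such that $$C\,\eta_{h,K}\le h_K\|A:\nabla(\boldsymbol\sigma-\boldsymbol\sigma_h)\|_{0,K}+\|\boldsymbol\sigma-\boldsymbol\sigma_h\|_{0,K}+\|\nabla(u-u_h)\|_{0,K}\quad\forall K\in\mathcal{T}.$$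
   Context: Setting: $d\in\{2,3\}$, $\Omega\subset\mathbb{R}^d$ is a bounded open polytope, $A=(a_{ij})\in L^\infty(\Omega)^{d\times d}$ (possibly degenerate). $A:B=\sum_{i,j}a_{ij}b_{ij}$; $D^2v$ is the Hessian. $\|\cdot\|_{s,\omega}$ is the $H^s(\omega)$ norm, with $\omega$ omitted when $\omega=\Omega$. Spaces: $V=\{v\in H^1_0(\Omega): A:D^2v\in L^2(\Omega)\}$, $Q=\{\boldsymbol\tau\in L^2(\Omega)^d: A:\nabla\boldsymbol\tau\in L^2(\Omega)\}$. Convention: $A:\nabla\boldsymbol\tau=\sum_{i,j}a_{ij}\,\partial_j\tau_i$ is linear in $\boldsymbol\tau$, coincides with the a.e. expression for $\boldsymbol\tau\in H^1(\Omega)^d$, and $A:\nabla(\nabla v)=A:D^2v$. Mesh: $\mathcal{T}=\{K\}$ is a shape-regular simplicial triangulation of $\Omega$, $h_K=\operatorname{diam}K$, $h=\max_Kh_K$. $S_k=\{v\in H^1(\Omega): v|_K\in P_k(K)\ \forall K\in\mathcal{T}\}$, $S_{k,0}=S_k\cap H^1_0(\Omega)$. $$\mathcal{J}_h(v,\boldsymbol\tau;f)=\sum_{K\in\mathcal{T}}h_K^2\|f+A:\nabla\boldsymbol\tau\|_{0,K}^2+\|\boldsymbol\tau-\nabla v\|_0^2,$$ $$|||(v,\boldsymbol\tau)|||_{h,K}^2=h_K^2\|A:\nabla\boldsymbol\tau\|_{0,K}^2+\|\boldsymbol\tau-\nabla v\|_{0,K}^2,\qquad |||(v,\boldsymbol\tau)|||_h^2=\sum_{K\in\mathcal{T}}|||(v,\boldsymbol\tau)|||_{h,K}^2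 .$$ *)

theory Defs
  imports "HOL-Analysis.Analysis"
begin

text \<open>
  Lebesgue and Sobolev functions are represented by total functions on \<^typ>\<open>real^'n\<close> of which only the
  values in the domain matter; equality in these spaces is equality almost everywhere.
\<close>

section \<open>Lebesgue spaces\<close>

definition eq_ae :: "(real^'n) set \<Rightarrow> (real^'n \<Rightarrow> 'b) \<Rightarrow> (real^'n \<Rightarrow> 'b) \<Rightarrow> bool" where
  "eq_ae \<omega> f g \<longleftrightarrow> (AE x in lebesgue_on \<omega>. f x = g x)"

definition L2 :: "(real^'n) set \<Rightarrow> (real^'n \<Rightarrow> 'b::euclidean_space) set" where
  "L2 \<omega> = {f. f \<in> borel_measurable (lebesgue_on \<omega>) \<and>
              integrable (lebesgue_on \<omega>) (\<lambda>x. (norm (f x))\<^sup>2)}"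

definition norm_L2 :: "(real^'n) set \<Rightarrow> (real^'n \<Rightarrow> 'b::euclidean_space) \<Rightarrow> real" where
  "norm_L2 \<omega> f = sqrt (integral\<^sup>L (lebesgue_on \<omega>) (\<lambda>x. (norm (f x))\<^sup>2))"

definition Linf_matrix :: "(real^'n) set \<Rightarrow> (real^'n \<Rightarrow> real^'n^'n) set" where
  "Linf_matrix \<omega> = {A. \<forall>i j. (\<lambda>x. A x $ i $ j) \<in> borel_measurable (lebesgue_on \<omega>) \<and>
                             (\<exists>M. AE x in lebesgue_on \<omega>. \<bar>A x $ i $ j\<bar> \<le> M)}"


section \<open>Weak gradients and the Sobolev spaces \<open>H\<^sup>1\<close>, \<open>H\<^sup>1\<^sub>0\<close>\<close>

definition partial :: "'n \<Rightarrow> (real^'n \<Rightarrow> real) \<Rightarrow> real^'n \<Rightarrow> real" where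
  "partial i f x = frechet_derivative f (at x) (axis i 1)"

fun Ck :: "nat \<Rightarrow> (real^'n \<Rightarrow> real) \<Rightarrow> bool" where
  "Ck 0 f \<longleftrightarrow> continuous_on UNIV f"
| "Ck (Suc m) f \<longleftrightarrow> (\<forall>x. f differentiable (at x)) \<and> (\<forall>i. Ck m (partial i f))"

definition test_functions :: "(real^'n) set \<Rightarrow> (real^'n \<Rightarrow> real) set" where
  "test_functions \<Omega> = {\<phi>. (\<forall>m. Ck m \<phi>) \<and> compact (closure {x. \<phi> x \<noteq> 0}) \<and>
                          closure {x. \<phi> x \<noteq> 0} \<subseteq> \<Omega>}"

definition is_weak_grad :: "(real^'n) set \<Rightarrow> (real^'n \<Rightarrow> real) \<Rightarrow> (real^'n \<Rightarrow> real^'n) \<Rightarrow> bool" where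
  "is_weak_grad \<Omega> v G \<longleftrightarrow>
     (\<forall>\<phi>\<in>test_functions \<Omega>. \<forall>i.
        integral\<^sup>L (lebesgue_on \<Omega>) (\<lambda>x. v x * partial i \<phi> x) =
        - integral\<^sup>L (lebesgue_on \<Omega>) (\<lambda>x. G x $ i * \<phi> x))"

definition H1 :: "(real^'n) set \<Rightarrow> (real^'n \<Rightarrow> real) set" where
  "H1 \<Omega> = {v. v \<in> L2 \<Omega> \<and> (\<exists>G. G \<in> L2 \<Omega> \<and> is_weak_grad \<Omega> v G)}"

text \<open>The weak gradient of an \<open>H\<^sup>1\<close> function (determined up to null sets).\<close>

definition weak_grad :: "(real^'n) set \<Rightarrow> (real^'n \<Rightarrow> real) \<Rightarrow> real^'n \<Rightarrow> real^'n" where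
  "weak_grad \<Omega> v = (SOME G. G \<in> L2 \<Omega> \<and> is_weak_grad \<Omega> v G)"

definition norm_H1 :: "(real^'n) set \<Rightarrow> (real^'n \<Rightarrow> real) \<Rightarrow> real" where
  "norm_H1 \<Omega> v = sqrt ((norm_L2 \<Omega> v)\<^sup>2 + (norm_L2 \<Omega> (weak_grad \<Omega> v))\<^sup>2)"

definition H1_0 :: "(real^'n) set \<Rightarrow> (real^'n \<Rightarrow> real) set" where
  "H1_0 \<Omega> = {v \<in> H1 \<Omega>. \<forall>\<epsilon>>0. \<exists>\<phi>\<in>test_functions \<Omega>. norm_H1 \<Omega> (\<lambda>x. v x - \<phi> x) < \<epsilon>}"

definition vec_space :: "(real^'n \<Rightarrow> real) set \<Rightarrow> (real^'n \<Rightarrow> real^'n) set" where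
  "vec_space W = {\<tau>. \<forall>i. (\<lambda>x. \<tau> x $ i) \<in> W}"


section \<open>The operator \<open>A : \<nabla>\<close> and the spaces \<open>Q\<close> and \<open>V\<close>\<close>

definition A_grad_H1 ::
    "(real^'n) set \<Rightarrow> (real^'n \<Rightarrow> real^'n^'n) \<Rightarrow> (real^'n \<Rightarrow> real^'n) \<Rightarrow> real^'n \<Rightarrow> real" where
  "A_grad_H1 \<Omega> A \<tau> x =
     (\<Sum>i\<in>UNIV. \<Sum>j\<in>UNIV. A x $ i $ j * weak_grad \<Omega> (\<lambda>y. \<tau> y $ i) x $ j)"

text \<open>
  For \<open>\<tau>\<close> merely in \<open>L\<^sup>2\<close> and \<open>A\<close> merely in \<open>L\<^sup>\<infinity>\<close> the products \<open>a\<^sub>i\<^sub>j \<partial>\<^sub>j\<tau>\<^sub>i\<close> have no canonical meaning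
  (not even as distributions). What is fixed about \<open>A : \<nabla>\<tau>\<close> is that it is linear in \<open>\<tau>\<close>, depends
  only on the almost-everywhere classes, and is the pointwise expression for \<open>\<tau> \<in> H\<^sup>1\<close>. A relation
  \<open>R\<close>, with \<open>R \<tau> g\<close> read as ``\<open>A : \<nabla>\<tau>\<close> is the \<open>L\<^sup>2\<close> function \<open>g\<close>'', is an admissible reading of the
  operator iff it has these properties; everything below is stated for an arbitrary admissible \<open>R\<close>.
\<close>

definition A_grad_reading ::
    "(real^'n) set \<Rightarrow> (real^'n \<Rightarrow> real^'n^'n) \<Rightarrow> ((real^'n \<Rightarrow> real^'n) \<Rightarrow> (real^'n \<Rightarrow> real) \<Rightarrow> bool) \<Rightarrow> bool"
  where
  "A_grad_reading \<Omega> A R \<longleftrightarrow>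
     (\<forall>\<tau>\<in>L2 \<Omega>. \<forall>\<tau>'\<in>L2 \<Omega>. \<forall>g\<in>L2 \<Omega>. \<forall>g'\<in>L2 \<Omega>.
        eq_ae \<Omega> \<tau> \<tau>' \<longrightarrow> eq_ae \<Omega> g g' \<longrightarrow> R \<tau> g \<longrightarrow> R \<tau>' g') \<and>
     (\<forall>\<tau>\<in>L2 \<Omega>. \<forall>g\<in>L2 \<Omega>. \<forall>g'\<in>L2 \<Omega>. R \<tau> g \<longrightarrow> R \<tau> g' \<longrightarrow> eq_ae \<Omega> g g') \<and>
     (\<forall>\<tau>\<in>L2 \<Omega>. \<forall>\<tau>'\<in>L2 \<Omega>. \<forall>g\<in>L2 \<Omega>. \<forall>g'\<in>L2 \<Omega>. \<forall>a b.
        R \<tau> g \<longrightarrow> R \<tau>' g' \<longrightarrow> R (\<lambda>x. a *\<^sub>R \<tau> x + b *\<^sub>R \<tau>' x) (\<lambda>x. a * g x + b * g' x)) \<and>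
     (\<forall>\<tau>\<in>vec_space (H1 \<Omega>). R \<tau> (A_grad_H1 \<Omega> A \<tau>))"

definition Q_space ::
    "(real^'n) set \<Rightarrow> ((real^'n \<Rightarrow> real^'n) \<Rightarrow> (real^'n \<Rightarrow> real) \<Rightarrow> bool) \<Rightarrow> (real^'n \<Rightarrow> real^'n) set" where
  "Q_space \<Omega> R = {\<tau> \<in> L2 \<Omega>. \<exists>g\<in>L2 \<Omega>. R \<tau> g}"

definition A_grad ::
    "(real^'n) set \<Rightarrow> ((real^'n \<Rightarrow> real^'n) \<Rightarrow> (real^'n \<Rightarrow> real) \<Rightarrow> bool) \<Rightarrow> (real^'n \<Rightarrow> real^'n) \<Rightarrow> real^'n \<Rightarrow> real"
  where
  "A_grad \<Omega> R \<tau> = (SOME g. g \<in> L2 \<Omega> \<and> R \<tau> g)"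

text \<open>\<open>A : D\<^sup>2v\<close> is \<open>A : \<nabla>(\<nabla>v)\<close>.\<close>

definition V_space ::
    "(real^'n) set \<Rightarrow> ((real^'n \<Rightarrow> real^'n) \<Rightarrow> (real^'n \<Rightarrow> real) \<Rightarrow> bool) \<Rightarrow> (real^'n \<Rightarrow> real) set" where
  "V_space \<Omega> R = {v \<in> H1_0 \<Omega>. \<exists>g\<in>L2 \<Omega>. R (weak_grad \<Omega> v) g}"

definition A_hess ::
    "(real^'n) set \<Rightarrow> ((real^'n \<Rightarrow> real^'n) \<Rightarrow> (real^'n \<Rightarrow> real) \<Rightarrow> bool) \<Rightarrow> (real^'n \<Rightarrow> real) \<Rightarrow> real^'n \<Rightarrow> real"
  where
  "A_hess \<Omega> R v = A_grad \<Omega> R (weak_grad \<Omega> v)"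

text \<open>\<open>v\<close> solves \<open>- A : D\<^sup>2v = g\<close> in \<open>\<Omega>\<close>, \<open>v = 0\<close> on \<open>\<partial>\<Omega>\<close>.\<close>

definition solves ::
    "(real^'n) set \<Rightarrow> ((real^'n \<Rightarrow> real^'n) \<Rightarrow> (real^'n \<Rightarrow> real) \<Rightarrow> bool) \<Rightarrow> (real^'n \<Rightarrow> real) \<Rightarrow>
     (real^'n \<Rightarrow> real) \<Rightarrow> bool"
  where
  "solves \<Omega> R g v \<longleftrightarrow> v \<in> V_space \<Omega> R \<and> eq_ae \<Omega> (\<lambda>x. - A_hess \<Omega> R v x) g"

definition uniquely_solvable ::
    "(real^'n) set \<Rightarrow> ((real^'n \<Rightarrow> real^'n) \<Rightarrow> (real^'n \<Rightarrow> real) \<Rightarrow> bool) \<Rightarrow> bool" where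
  "uniquely_solvable \<Omega> R \<longleftrightarrow>
     (\<forall>g\<in>L2 \<Omega>. \<exists>v. solves \<Omega> R g v \<and> (\<forall>w. solves \<Omega> R g w \<longrightarrow> eq_ae \<Omega> w v))"


section \<open>Domains, meshes and finite element spaces\<close>

text \<open>
  Domains need not be convex, so ``polytope'' means the interior of a finite union of convex
  polytopes (the library's \<^const>\<open>polytope\<close> is convex).
\<close>

definition bounded_open_polytope :: "(real^'n) set \<Rightarrow> bool" where
  "bounded_open_polytope \<Omega> \<longleftrightarrow>
     (\<exists>\<P>. finite \<P> \<and> (\<forall>P\<in>\<P>. polytope P) \<and> \<Omega> = interior (\<Union>\<P>))"

definition inball_diameter :: "(real^'n) set \<Rightarrow> real" where
  "inball_diameter K = Sup {2 * r | r. 0 \<le> r \<and> (\<exists>x. cball x r \<subseteq> K)}"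

text \<open>
  Elements are closed \<open>d\<close>-simplices, conforming by \<^const>\<open>triangulation\<close>; \<open>\<kappa>\<close> bounds the shape
  regularity. An element differs from its part in \<open>\<Omega>\<close> only by a null set.
\<close>

definition shape_regular_mesh :: "(real^'n) set \<Rightarrow> real \<Rightarrow> (real^'n) set set \<Rightarrow> bool" where
  "shape_regular_mesh \<Omega> \<kappa> \<T> \<longleftrightarrow>
     triangulation \<T> \<and> (\<forall>K\<in>\<T>. int CARD('n) simplex K) \<and> \<Union>\<T> = closure \<Omega> \<and>
     (\<forall>K\<in>\<T>. diameter K \<le> \<kappa> * inball_diameter K)"

text \<open>Polynomial functions of total degree at most \<open>k\<close>; \<open>\<alpha>\<close> ranges over multi-indices.\<close>

definition poly_space :: "nat \<Rightarrow> (real^'n \<Rightarrow> real) set" where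
  "poly_space k =
     {p. \<exists>c :: ('n \<Rightarrow> nat) \<Rightarrow> real. \<forall>x. p x = (\<Sum>\<alpha> | (\<Sum>i\<in>UNIV. \<alpha> i) \<le> k. c \<alpha> * (\<Prod>i\<in>UNIV. x $ i ^ \<alpha> i))}"

definition S_space :: "(real^'n) set \<Rightarrow> (real^'n) set set \<Rightarrow> nat \<Rightarrow> (real^'n \<Rightarrow> real) set" where
  "S_space \<Omega> \<T> k = {v \<in> H1 \<Omega>. \<forall>K\<in>\<T>. \<exists>p\<in>poly_space k. eq_ae K v p}"

definition S0_space :: "(real^'n) set \<Rightarrow> (real^'n) set set \<Rightarrow> nat \<Rightarrow> (real^'n \<Rightarrow> real) set" where
  "S0_space \<Omega> \<T> k = S_space \<Omega> \<T> k \<inter> H1_0 \<Omega>"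


section \<open>Weighted least-squares functional, mesh-dependent norm and error indicator\<close>

definition LS_functional ::
    "(real^'n) set \<Rightarrow> ((real^'n \<Rightarrow> real^'n) \<Rightarrow> (real^'n \<Rightarrow> real) \<Rightarrow> bool) \<Rightarrow> (real^'n) set set \<Rightarrow>
     (real^'n \<Rightarrow> real) \<Rightarrow> (real^'n \<Rightarrow> real) \<times> (real^'n \<Rightarrow> real^'n) \<Rightarrow> real"
  where
  "LS_functional \<Omega> R \<T> f = (\<lambda>(v, \<tau>).
     (\<Sum>K\<in>\<T>. (diameter K)\<^sup>2 * (norm_L2 K (\<lambda>x. f x + A_grad \<Omega> R \<tau> x))\<^sup>2)
     + (norm_L2 \<Omega> (\<lambda>x. \<tau> x - weak_grad \<Omega> v x))\<^sup>2)"

definition energy_norm_K ::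
    "(real^'n) set \<Rightarrow> ((real^'n \<Rightarrow> real^'n) \<Rightarrow> (real^'n \<Rightarrow> real) \<Rightarrow> bool) \<Rightarrow> (real^'n) set \<Rightarrow>
     (real^'n \<Rightarrow> real) \<Rightarrow> (real^'n \<Rightarrow> real^'n) \<Rightarrow> real"
  where
  "energy_norm_K \<Omega> R K v \<tau> =
     sqrt ((diameter K)\<^sup>2 * (norm_L2 K (A_grad \<Omega> R \<tau>))\<^sup>2
           + (norm_L2 K (\<lambda>x. \<tau> x - weak_grad \<Omega> v x))\<^sup>2)"

definition energy_norm ::
    "(real^'n) set \<Rightarrow> ((real^'n \<Rightarrow> real^'n) \<Rightarrow> (real^'n \<Rightarrow> real) \<Rightarrow> bool) \<Rightarrow> (real^'n) set set \<Rightarrow>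
     (real^'n \<Rightarrow> real) \<Rightarrow> (real^'n \<Rightarrow> real^'n) \<Rightarrow> real"
  where
  "energy_norm \<Omega> R \<T> v \<tau> = sqrt (\<Sum>K\<in>\<T>. (energy_norm_K \<Omega> R K v \<tau>)\<^sup>2)"

definition eta_K ::
    "(real^'n) set \<Rightarrow> ((real^'n \<Rightarrow> real^'n) \<Rightarrow> (real^'n \<Rightarrow> real) \<Rightarrow> bool) \<Rightarrow> (real^'n) set \<Rightarrow>
     (real^'n \<Rightarrow> real) \<Rightarrow> (real^'n \<Rightarrow> real) \<Rightarrow> (real^'n \<Rightarrow> real^'n) \<Rightarrow> real"
  where
  "eta_K \<Omega> R K f u\<^sub>h \<sigma>\<^sub>h =
     sqrt ((diameter K)\<^sup>2 * (norm_L2 K (\<lambda>x. f x + A_grad \<Omega> R \<sigma>\<^sub>h x))\<^sup>2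
           + (norm_L2 K (\<lambda>x. \<sigma>\<^sub>h x - weak_grad \<Omega> u\<^sub>h x))\<^sup>2)"

definition eta ::
    "(real^'n) set \<Rightarrow> ((real^'n \<Rightarrow> real^'n) \<Rightarrow> (real^'n \<Rightarrow> real) \<Rightarrow> bool) \<Rightarrow> (real^'n) set set \<Rightarrow>
     (real^'n \<Rightarrow> real) \<Rightarrow> (real^'n \<Rightarrow> real) \<Rightarrow> (real^'n \<Rightarrow> real^'n) \<Rightarrow> real"
  where
  "eta \<Omega> R \<T> f u\<^sub>h \<sigma>\<^sub>h = sqrt (\<Sum>K\<in>\<T>. (eta_K \<Omega> R K f u\<^sub>h \<sigma>\<^sub>h)\<^sup>2)"

end

theory Submission
  imports Defs
begin

text \<open>
  Testing the functional with the exact solution and its gradient shows that its minimum over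
  \<open>H\<^sup>1\<^sub>0 \<times> Q\<close> is \<open>0\<close>. Hence the minimizer satisfies \<open>\<sigma> = \<nabla>u\<close> and \<open>- A : \<nabla>\<sigma> = f\<close>, so that the computable
  residuals of \<open>(u\<^sub>h, \<sigma>\<^sub>h)\<close> are the error terms up to sign; the efficiency bound then follows from
  \<open>|a - b|\<^sup>2 \<le> 2 |a|\<^sup>2 + 2 |b|\<^sup>2\<close>, with the absolute constant \<open>1/2\<close>. Linearity of the weak gradient up to null sets rests on
  its uniqueness, i.e. on the fundamental lemma of the calculus of variations. The latter is
  proved by approximating indicators of boxes by smooth bumps and Lebesgue differentiation.
\<close>

section \<open>Smooth bump functions\<close>

text \<open>For \<open>p = 1\<close> this is the classical flat function exp(-1/t). The polynomial
  factor in 1/t is carried along because differentiation produces such factors, so the whole family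
  is closed under derivatives.\<close>

definition flat_exp :: "real poly \<Rightarrow> real \<Rightarrow> real" where
  "flat_exp p t = (if t > 0 then poly p (1 / t) * exp (- (1 / t)) else 0)"

text \<open>Exponential decay beats every power. With s = 1/t this controls the difference quotient
  of \<open>flat_exp\<close> at the gluing point 0.\<close>

lemma poly_times_exp_neg_tendsto_0:
  fixes p :: "real poly"
  shows "((\<lambda>s. poly p s * exp (- s)) \<longlongrightarrow> 0) at_top"
proof -
  have "((\<lambda>s. \<Sum>i\<le>degree p. coeff p i * (s ^ i / exp s)) \<longlongrightarrow> (\<Sum>i\<le>degree p. coeff p i * 0)) at_top"
    by (intro tendsto_intros tendsto_power_div_exp_0)
  then show ?thesis
    by (simp add: poly_altdef sum_distrib_right exp_minus divide_inverse mult.assoc)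
qed

text \<open>Put s = 1/t, so ds/dt = -s^2. Then p(s) exp(-s) has the t-derivative s^2 (p(s) - p'(s))
  exp(-s), and \<open>monom 1 2\<close> is the factor s^2. Only t = 0 needs a limit
  argument.\<close>

lemma flat_exp_has_derivative:
  "(flat_exp p has_real_derivative flat_exp (monom 1 2 * (p - pderiv p)) t) (at t)"
proof (cases t "0::real" rule: linorder_cases)
  case less
  have "((\<lambda>_. 0) has_real_derivative 0) (at t)"
    by simp
  then show ?thesis
    by (rule has_field_derivative_transform_within_open[where S = "{..<0}", THEN DERIV_cong])
       (use less in \<open>auto simp: flat_exp_def\<close>)
next
  case equal
  have "((\<lambda>y. flat_exp p y / y) \<longlongrightarrow> 0) (at_left 0)"
    by (rule tendsto_eventually) (auto simp: eventually_at_left_field flat_exp_def intro!: exI[of _ "-1"])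
  \<comment> \<open>Substituting s = 1/y turns the quotient into s p(s) exp(-s). The polynomial s
    p(s) is \<open>pCons 0 p\<close>.\<close>
  moreover have "((\<lambda>y. flat_exp p y / y) \<longlongrightarrow> 0) (at_right 0)"
    unfolding filterlim_at_right_to_top
  proof (rule Lim_transform_eventually[OF poly_times_exp_neg_tendsto_0[of "pCons 0 p"]])
    show "\<forall>\<^sub>F s in at_top. poly (pCons 0 p) s * exp (- s) = flat_exp p (inverse s) / inverse s"
      using eventually_gt_at_top[of "0::real"]
      by eventually_elim (simp add: flat_exp_def field_simps)
  qed
  ultimately have "((\<lambda>y. flat_exp p y / y) \<longlongrightarrow> 0) (at 0)"
    by (rule filterlim_split_at)
  then show ?thesis
    using equal by (simp add: has_field_derivative_iff flat_exp_def)
next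
  case greater
  have "((\<lambda>t. poly p (1 / t) * exp (- (1 / t))) has_real_derivative
          poly (monom 1 2 * (p - pderiv p)) (1 / t) * exp (- (1 / t))) (at t)"
    using greater
    by (auto intro!: derivative_eq_intros DERIV_chain2[OF poly_DERIV]
        simp: poly_monom field_simps power2_eq_square)
  then show ?thesis
    by (rule has_field_derivative_transform_within_open[where S = "{0<..}", THEN DERIV_cong])
       (use greater in \<open>auto simp: flat_exp_def\<close>)
qed

lemma flat_exp_1_bounds: "0 \<le> flat_exp 1 t" "flat_exp 1 t \<le> 1"
  by (auto simp: flat_exp_def)

lemma flat_exp_1_eq_0_iff: "flat_exp 1 t = 0 \<longleftrightarrow> t \<le> 0"
  by (auto simp: flat_exp_def)

text \<open>The scale is \<open>Suc n\<close> rather than \<open>n\<close> so that it is positive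
  for every n; each bump is then nonzero exactly on the open box.\<close>

lemma flat_exp_1_scaled_tendsto:
  "(\<lambda>n. flat_exp 1 (real (Suc n) * t)) \<longlonglongrightarrow> (if t > 0 then 1 else 0)"
proof (cases "t > 0")
  case True
  have "(\<lambda>n. exp (- (inverse (real (Suc n)) * (1 / t)))) \<longlonglongrightarrow> exp (- (0 * (1 / t)))"
    by (intro tendsto_intros LIMSEQ_inverse_real_of_nat)
  moreover have "flat_exp 1 (real (Suc n) * t) = exp (- (inverse (real (Suc n)) * (1 / t)))" for n
    using True by (simp add: flat_exp_def field_simps del: of_nat_Suc)
  ultimately show ?thesis
    using True by simp
next
  case False
  then have "real (Suc n) * t \<le> 0" for n
    by (simp add: mult_nonneg_nonpos)
  then have "flat_exp 1 (real (Suc n) * t) = 0" for n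
    by (simp add: flat_exp_1_eq_0_iff)
  with False show ?thesis
    by simp
qed

text \<open>This algebra is closed under partial derivatives, so all its members are smooth.\<close>

inductive_set flat_algebra :: "(real^'n \<Rightarrow> real) set" where
  flat: "(\<lambda>x. flat_exp p (c * (x $ i - a))) \<in> flat_algebra"
| const: "(\<lambda>x. c) \<in> flat_algebra"
| add: "f \<in> flat_algebra \<Longrightarrow> g \<in> flat_algebra \<Longrightarrow> (\<lambda>x. f x + g x) \<in> flat_algebra"
| mult: "f \<in> flat_algebra \<Longrightarrow> g \<in> flat_algebra \<Longrightarrow> (\<lambda>x. f x * g x) \<in> flat_algebra"

lemma flat_algebra_prod:
  "finite I \<Longrightarrow> (\<And>i. i \<in> I \<Longrightarrow> f i \<in> flat_algebra) \<Longrightarrow> (\<lambda>x. \<Prod>i\<in>I. f i x) \<in> flat_algebra"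
  by (induction I rule: finite_induct) (auto intro: flat_algebra.const flat_algebra.mult)

text \<open>The induction carries the total derivative together with membership of its coefficients
  in the algebra: the sum and product rules then apply directly, and the coefficients turn out to be
  the partial derivatives.\<close>

lemma flat_algebra_has_derivative:
  fixes f :: "real^'n \<Rightarrow> real"
  assumes "f \<in> flat_algebra"
  shows "\<exists>D. (\<forall>i. D i \<in> flat_algebra) \<and> (\<forall>x. (f has_derivative (\<lambda>h. \<Sum>i\<in>UNIV. h $ i * D i x)) (at x))"
  using assms
proof induction
  case (flat p c i a)
  define q where "q = monom 1 2 * (p - pderiv p)"
  define D where "D = (\<lambda>j (x::real^'n). (if j = i then c else 0) * flat_exp q (c * (x $ i - a)))"
  have "((\<lambda>x. flat_exp p (c * (x $ i - a))) has_derivative (\<lambda>h. \<Sum>j\<in>UNIV. h $ j * D j x)) (at x)" for x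
  proof -
    have "((\<lambda>x::real^'n. c * (x $ i - a)) has_derivative (\<lambda>h. c * h $ i)) (at x)"
      by (auto intro!: derivative_eq_intros bounded_linear_imp_has_derivative bounded_linear_vec_nth)
    from has_derivative_compose[OF this flat_exp_has_derivative[of p, unfolded has_field_derivative_def]]
    show ?thesis
      by (simp add: D_def q_def if_distrib[of "\<lambda>z. z * _"] if_distrib[of "\<lambda>z. _ * z"] mult_ac cong: if_cong)
  qed
  moreover have "D j \<in> flat_algebra" for j
    unfolding D_def by (intro flat_algebra.mult flat_algebra.const flat_algebra.flat)
  ultimately show ?case
    by blast
next
  case (const c)
  show ?case
    by (intro exI[of _ "\<lambda>i x. 0"]) (auto intro: flat_algebra.const)
next
  case (add f g)
  then obtain D E where "\<forall>i. D i \<in> flat_algebra" "\<forall>i. E i \<in> flat_algebra"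
    "\<forall>x. (f has_derivative (\<lambda>h. \<Sum>i\<in>UNIV. h $ i * D i x)) (at x)"
    "\<forall>x. (g has_derivative (\<lambda>h. \<Sum>i\<in>UNIV. h $ i * E i x)) (at x)"
    by blast
  then show ?case
    by (intro exI[of _ "\<lambda>i x. D i x + E i x"])
       (auto intro!: flat_algebra.add derivative_eq_intros simp: sum.distrib distrib_left)
next
  case (mult f g)
  then obtain D E where D: "\<forall>i. D i \<in> flat_algebra" "\<forall>i. E i \<in> flat_algebra"
    "\<forall>x. (f has_derivative (\<lambda>h. \<Sum>i\<in>UNIV. h $ i * D i x)) (at x)"
    "\<forall>x. (g has_derivative (\<lambda>h. \<Sum>i\<in>UNIV. h $ i * E i x)) (at x)"
    by blast
  have "((\<lambda>x. f x * g x) has_derivative (\<lambda>h. \<Sum>i\<in>UNIV. h $ i * (f x * E i x + D i x * g x))) (at x)" for x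
    by (rule has_derivative_eq_rhs[OF has_derivative_mult[OF D(3)[rule_format] D(4)[rule_format]]])
       (simp add: sum.distrib distrib_left sum_distrib_left sum_distrib_right mult_ac)
  with D mult.hyps show ?case
    by (intro exI[of _ "\<lambda>i x. f x * E i x + D i x * g x"])
       (auto intro!: flat_algebra.add flat_algebra.mult)
qed

lemma flat_algebra_partial:
  assumes "f \<in> flat_algebra"
  shows "f differentiable (at x)" "partial i f \<in> flat_algebra"
proof -
  obtain D where D: "\<forall>i. D i \<in> flat_algebra"
    "\<And>x. (f has_derivative (\<lambda>h. \<Sum>i\<in>UNIV. h $ i * D i x)) (at x)"
    using flat_algebra_has_derivative[OF assms] by blast
  show "f differentiable (at x)"
    using D(2) differentiable_def by blast
  have "partial i f = D i"
    by (rule ext)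
       (simp add: partial_def frechet_derivative_at[OF D(2), symmetric] axis_def
          if_distrib[of "\<lambda>z. z * _"] cong: if_cong)
  with D show "partial i f \<in> flat_algebra"
    by simp
qed

text \<open>\<open>Ck (Suc m)\<close> passes from the function to its partial derivatives, so the
  induction on m must leave the function arbitrary.\<close>

lemma flat_algebra_Ck: "f \<in> flat_algebra \<Longrightarrow> Ck m f"
proof (induction m arbitrary: f)
  case 0
  then show ?case
    using flat_algebra_partial(1) by (auto intro!: continuous_at_imp_continuous_on differentiable_imp_continuous_within)
next
  case (Suc m)
  then show ?case
    by (auto intro: flat_algebra_partial)
qed

text \<open>Since \<open>exp (- 1/(n t))\<close> tends to \<open>1\<close> for \<open>t > 0\<close>, the bumps tend to the indicator of the open box.\<close>

definition box_bump :: "nat \<Rightarrow> real^'n \<Rightarrow> real^'n \<Rightarrow> real^'n \<Rightarrow> real" where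
  "box_bump n a b x = (\<Prod>i\<in>UNIV. flat_exp 1 (real (Suc n) * (x $ i - a $ i)) * flat_exp 1 (real (Suc n) * (b $ i - x $ i)))"

lemma box_bump_bounds: "0 \<le> box_bump n a b x" "box_bump n a b x \<le> 1"
  unfolding box_bump_def
  by (auto intro!: prod_nonneg prod_le_1 mult_le_one simp: flat_exp_1_bounds simp del: of_nat_Suc)

lemma box_bump_eq_0_iff: "box_bump n a b x = 0 \<longleftrightarrow> x \<notin> box a b"
  by (auto simp: box_bump_def mem_box_cart flat_exp_1_eq_0_iff mult_le_0_iff not_less not_le simp del: of_nat_Suc)

lemma box_bump_in_flat_algebra:
  fixes a b :: "real^'n"
  shows "box_bump n a b \<in> flat_algebra"
proof -
  \<comment> \<open>The rule \<open>flat\<close> only admits arguments c (x_i - a). The cutoff at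
    the upper face fits this form with a negative c.\<close>
  have "(\<lambda>x::real^'n. flat_exp 1 (real (Suc n) * (x $ i - a $ i)) * flat_exp 1 ((- real (Suc n)) * (x $ i - b $ i))) \<in> flat_algebra" for i
    by (intro flat_algebra.mult flat_algebra.flat)
  moreover have "(- real (Suc n)) * (x $ i - b $ i) = real (Suc n) * (b $ i - x $ i)" for x i
    by (simp add: algebra_simps)
  ultimately show ?thesis
    unfolding box_bump_def[abs_def] by (intro flat_algebra_prod) (simp_all del: of_nat_Suc)
qed

lemma box_bump_test_function:
  assumes "cbox a b \<subseteq> \<Omega>"
  shows "box_bump n a b \<in> test_functions \<Omega>"
proof -
  have "closure {x. box_bump n a b x \<noteq> 0} \<subseteq> cbox a b"
    by (rule closure_minimal) (auto simp: box_bump_eq_0_iff intro: box_subset_cbox[THEN subsetD])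
  then show ?thesis
    using assms unfolding test_functions_def
    by (auto intro!: flat_algebra_Ck box_bump_in_flat_algebra bounded_subset[OF bounded_cbox] simp: compact_eq_bounded_closed)
qed

lemma box_bump_tendsto: "(\<lambda>n. box_bump n a b x) \<longlonglongrightarrow> indicator (box a b) x"
proof -
  have "(\<lambda>n. box_bump n a b x) \<longlonglongrightarrow>
    (\<Prod>i\<in>UNIV. (if x $ i - a $ i > 0 then 1 else 0) * (if b $ i - x $ i > 0 then 1 else 0))"
    unfolding box_bump_def by (intro tendsto_intros flat_exp_1_scaled_tendsto)
  also have "(\<Prod>i\<in>UNIV. (if x $ i - a $ i > 0 then 1 else 0) * (if b $ i - x $ i > 0 then 1 else (0::real)))
     = indicator (box a b) x"
    by (auto simp: indicator_def mem_box_cart)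
  finally show ?thesis .
qed
section \<open>The fundamental lemma of the calculus of variations\<close>

lemma test_function_continuous:
  assumes "\<phi> \<in> test_functions \<Omega>"
  shows "continuous_on UNIV \<phi>" "continuous_on UNIV (partial i \<phi>)"
proof -
  have "Ck 0 \<phi>" "Ck (Suc 0) \<phi>"
    using assms by (auto simp: test_functions_def)
  then show "continuous_on UNIV \<phi>" "continuous_on UNIV (partial i \<phi>)"
    by auto
qed

text \<open>The bumps are test functions bounded by 1 that converge to the indicator of the open
  box. Dominated convergence with majorant |g| carries the orthogonality over to this
  indicator.\<close>

lemma integral_cbox_eq_0:
  fixes g :: "real^'n \<Rightarrow> real"
  assumes \<Omega>: "open \<Omega>" and g: "integrable (lebesgue_on \<Omega>) g"
    and orth: "\<And>\<phi>. \<phi> \<in> test_functions \<Omega> \<Longrightarrow> integral\<^sup>L (lebesgue_on \<Omega>) (\<lambda>x. g x * \<phi> x) = 0"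
    and ab: "cbox a b \<subseteq> \<Omega>"
  shows "integral (cbox a b) g = 0"
proof -
  have meas [measurable]: "g \<in> borel_measurable (lebesgue_on \<Omega>)"
    using g by auto
  have \<Omega>': "\<Omega> \<in> sets lebesgue"
    using \<Omega> by (simp add: borel_open)
  have bump [measurable]: "box_bump n a b \<in> borel_measurable (lebesgue_on \<Omega>)" for n
    using test_function_continuous(1)[OF box_bump_test_function[OF ab]]
    by (intro continuous_imp_measurable_on_sets_lebesgue \<Omega>') (rule continuous_on_subset, auto)
  have ind: "(\<lambda>x. g x * indicator (box a b) x) \<in> borel_measurable (lebesgue_on \<Omega>)"
    by (rule borel_measurable_LIMSEQ_metric[where f = "\<lambda>n x. g x * box_bump n a b x"])
       (auto intro!: tendsto_intros box_bump_tendsto)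
  have "(\<lambda>n. integral\<^sup>L (lebesgue_on \<Omega>) (\<lambda>x. g x * box_bump n a b x))
          \<longlonglongrightarrow> integral\<^sup>L (lebesgue_on \<Omega>) (\<lambda>x. g x * indicator (box a b) x)"
  proof (rule integral_dominated_convergence[where w = "\<lambda>x. \<bar>g x\<bar>"])
    show "AE x in lebesgue_on \<Omega>. (\<lambda>n. g x * box_bump n a b x) \<longlonglongrightarrow> g x * indicator (box a b) x"
      by (intro always_eventually allI tendsto_intros box_bump_tendsto)
    show "AE x in lebesgue_on \<Omega>. norm (g x * box_bump n a b x) \<le> \<bar>g x\<bar>" for n
      by (intro always_eventually allI)
         (simp add: abs_mult mult_left_le box_bump_bounds)
  qed (use g ind in auto)
  then have zero: "integral\<^sup>L (lebesgue_on \<Omega>) (\<lambda>x. g x * indicator (box a b) x) = 0"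
    using orth[OF box_bump_test_function[OF ab]] by (simp add: LIMSEQ_const_iff)
  have "integrable (lebesgue_on \<Omega>) (\<lambda>x. g x * indicator (box a b) x)"
    by (rule Bochner_Integration.integrable_bound[OF g ind]) (auto simp: indicator_def)
  \<comment> \<open>Here the Lebesgue integral becomes a gauge integral, the form in which cube
    averages are differentiated later. Open and closed boxes give the same gauge integral.\<close>
  from has_integral_integral_lebesgue_on[OF this \<Omega>'] zero
  have "((\<lambda>x. if x \<in> box a b then g x else 0) has_integral 0) \<Omega>"
    by (auto elim!: has_integral_eq[rotated])
  then have "(g has_integral 0) (box a b)"
    using ab box_subset_cbox[of a b] by (subst (asm) has_integral_restrict) auto
  then show ?thesis
    by (auto simp: has_integral_open_interval intro: integral_unique)
qed

lemma cube_subset_ball: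
  fixes x :: "'a::euclidean_space"
  assumes "h * real DIM('a) < e"
  shows "cbox x (x + h *\<^sub>R One) \<subseteq> ball x e"
proof
  fix y assume y: "y \<in> cbox x (x + h *\<^sub>R One)"
  have "norm (y - x) \<le> (\<Sum>i\<in>Basis. \<bar>(y - x) \<bullet> i\<bar>)"
    by (rule norm_le_l1)
  also have "\<dots> \<le> (\<Sum>i\<in>(Basis::'a set). h)"
    using y by (intro sum_mono) (auto simp: mem_box inner_diff_left inner_add_left)
  also have "\<dots> < e"
    using assms by (simp add: mult.commute)
  finally show "y \<in> ball x e"
    by (simp add: dist_norm norm_minus_commute)
qed

text \<open>By Lebesgue differentiation, g(x) is for almost every x the limit of averages of g over
  shrinking cubes. Cubes inside \<Omega> have average 0 by
  \<open>integral_cbox_eq_0\<close>.\<close>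

lemma fundamental_lemma_calculus_of_variations:
  fixes g :: "real^'n \<Rightarrow> real"
  assumes \<Omega>: "open \<Omega>" and g: "integrable (lebesgue_on \<Omega>) g"
    and orth: "\<And>\<phi>. \<phi> \<in> test_functions \<Omega> \<Longrightarrow> integral\<^sup>L (lebesgue_on \<Omega>) (\<lambda>x. g x * \<phi> x) = 0"
  shows "AE x in lebesgue_on \<Omega>. g x = 0"
proof -
  \<comment> \<open>Extension by zero makes the function integrable on every box, as the
    differentiation theorem requires.\<close>
  define G where "G = (\<lambda>x. if x \<in> \<Omega> then g x else 0)"
  have \<Omega>': "\<Omega> \<in> sets lebesgue"
    using \<Omega> by (simp add: borel_open)
  have "G integrable_on UNIV"
    using integrable_on_lebesgue_on[OF g \<Omega>'] by (simp add: G_def Henstock_Kurzweil_Integration.integrable_restrict_UNIV)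
  then have "G integrable_on cbox a b" for a b
    by (rule integrable_on_subcbox) simp
  then obtain N where N: "negligible N" and
    diff: "\<And>x e. x \<notin> N \<Longrightarrow> 0 < e \<Longrightarrow> \<exists>d>0. \<forall>h. 0 < h \<and> h < d \<longrightarrow>
       norm (integral (cbox x (x + h *\<^sub>R One)) G /\<^sub>R h ^ DIM(real^'n) - G x) < e"
    using integrable_ccontinuous_explicit[of G] by blast
  have "g x = 0" if x: "x \<in> \<Omega>" "x \<notin> N" for x
  proof (rule ccontr)
    assume "g x \<noteq> 0"
    then have "0 < norm (G x)"
      using x by (simp add: G_def)
    \<comment> \<open>The tolerance is |G x| itself: an average equal to 0 would then yield |G x| <
      |G x|.\<close>
    from diff[OF x(2) this] obtain d where d: "d > 0"
      "\<And>h. 0 < h \<Longrightarrow> h < d \<Longrightarrow>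
         norm (integral (cbox x (x + h *\<^sub>R One)) G /\<^sub>R h ^ DIM(real^'n) - G x) < norm (G x)"
      by blast
    obtain e where e: "e > 0" "ball x e \<subseteq> \<Omega>"
      using \<Omega> x(1) open_contains_ball by blast
    \<comment> \<open>The first term keeps h below the differentiation threshold d. The second makes
      the sum of the side lengths less than e, so the cube stays in the ball by
      \<open>cube_subset_ball\<close>.\<close>
    define h where "h = min (d / 2) (e / (2 * DIM(real^'n)))"
    have h: "0 < h" "h < d" "h * real DIM(real^'n) < e"
      using d(1) e(1) by (auto simp: h_def min_def field_simps)
    have sub: "cbox x (x + h *\<^sub>R One) \<subseteq> \<Omega>"
      using cube_subset_ball[OF h(3)] e(2) by blast
    have "integral (cbox x (x + h *\<^sub>R One)) G = integral (cbox x (x + h *\<^sub>R One)) g"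
      using sub by (intro Henstock_Kurzweil_Integration.integral_cong) (auto simp: G_def)
    also have "\<dots> = 0"
      by (rule integral_cbox_eq_0[OF \<Omega> g orth sub])
    finally show False
      using d(2)[OF h(1,2)] by simp
  qed
  then have "AE x in lebesgue. x \<in> \<Omega> \<longrightarrow> g x = 0"
    using N by (intro AE_I'[of N]) (auto simp: negligible_iff_null_sets)
  then show ?thesis
    using \<Omega>' by (simp add: AE_restrict_space_iff)
qed

section \<open>Lebesgue spaces\<close>

text \<open>This is the parallelogram law with the term |a - b|^2 dropped.\<close>

lemma norm_add_squared_le:
  fixes a b :: "'a::real_inner"
  shows "(norm (a + b))\<^sup>2 \<le> 2 * (norm a)\<^sup>2 + 2 * (norm b)\<^sup>2"
proof -
  have "(norm (a + b))\<^sup>2 + (norm (a - b))\<^sup>2 = 2 * (norm a)\<^sup>2 + 2 * (norm b)\<^sup>2"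
    by (simp add: power2_norm_eq_inner algebra_simps inner_commute)
  then show ?thesis
    by (smt (verit) zero_le_power2)
qed

lemma L2_measurable: "f \<in> L2 \<omega> \<Longrightarrow> f \<in> borel_measurable (lebesgue_on \<omega>)"
  by (simp add: L2_def)

lemma L2_integrable_norm_squared:
  "f \<in> L2 \<omega> \<Longrightarrow> integrable (lebesgue_on \<omega>) (\<lambda>x. (norm (f x))\<^sup>2)"
  by (simp add: L2_def)

lemma L2_bounded_by:
  assumes "f \<in> borel_measurable (lebesgue_on \<omega>)" "integrable (lebesgue_on \<omega>) g"
    and "AE x in lebesgue_on \<omega>. (norm (f x))\<^sup>2 \<le> g x"
  shows "f \<in> L2 \<omega>"
  unfolding L2_def using assms
  by (auto intro!: Bochner_Integration.integrable_bound[OF assms(2)])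

lemma L2_add:
  assumes "f \<in> L2 \<omega>" "g \<in> L2 \<omega>"
  shows "(\<lambda>x. f x + g x) \<in> L2 \<omega>"
proof (rule L2_bounded_by)
  show "AE x in lebesgue_on \<omega>. (norm (f x + g x))\<^sup>2 \<le> 2 * (norm (f x))\<^sup>2 + 2 * (norm (g x))\<^sup>2"
    by (intro always_eventually allI norm_add_squared_le)
qed (intro borel_measurable_add Bochner_Integration.integrable_add integrable_mult_right
      L2_measurable L2_integrable_norm_squared assms)+

lemma L2_minus: "f \<in> L2 \<omega> \<Longrightarrow> (\<lambda>x. - f x) \<in> L2 \<omega>"
  by (simp add: L2_def)

lemma L2_diff:
  assumes "f \<in> L2 \<omega>" "g \<in> L2 \<omega>"
  shows "(\<lambda>x. f x - g x) \<in> L2 \<omega>"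
  using L2_add[OF assms(1) L2_minus[OF assms(2)]] by simp

lemma L2_sum:
  "finite I \<Longrightarrow> (\<And>i. i \<in> I \<Longrightarrow> f i \<in> L2 \<omega>) \<Longrightarrow> (\<lambda>x. \<Sum>i\<in>I. f i x) \<in> L2 \<omega>"
proof (induction I rule: finite_induct)
  case empty
  then show ?case
    by (simp add: L2_def)
next
  case (insert i I)
  then show ?case
    by (auto intro: L2_add)
qed

lemma L2_bounded_mult:
  fixes f b :: "real^'n \<Rightarrow> real"
  assumes "f \<in> L2 \<omega>" and "b \<in> borel_measurable (lebesgue_on \<omega>)" and "AE x in lebesgue_on \<omega>. \<bar>b x\<bar> \<le> M"
  shows "(\<lambda>x. b x * f x) \<in> L2 \<omega>"
proof (rule L2_bounded_by[where g = "\<lambda>x. M\<^sup>2 * (norm (f x))\<^sup>2"])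
  show "AE x in lebesgue_on \<omega>. (norm (b x * f x))\<^sup>2 \<le> M\<^sup>2 * (norm (f x))\<^sup>2"
    using assms(3)
    by eventually_elim (auto simp: power_mult_distrib intro!: mult_right_mono simp flip: abs_le_square_iff)
qed (intro borel_measurable_times integrable_mult_right L2_measurable L2_integrable_norm_squared assms)+

lemma L2_vec_component:
  assumes "G \<in> L2 \<omega>"
  shows "(\<lambda>x. (G x :: real^'m) $ i) \<in> L2 \<omega>"
proof (rule L2_bounded_by[OF _ L2_integrable_norm_squared[OF assms]])
  have "(\<lambda>y::real^'m. y $ i) \<in> borel_measurable borel"
    by (intro borel_measurable_continuous_onI continuous_intros)
  then show "(\<lambda>x. G x $ i) \<in> borel_measurable (lebesgue_on \<omega>)"
    by (rule measurable_compose[OF L2_measurable[OF assms]])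
  show "AE x in lebesgue_on \<omega>. (norm (G x $ i))\<^sup>2 \<le> (norm (G x))\<^sup>2"
    by (intro always_eventually allI power_mono component_le_norm_cart) (auto simp: component_le_norm_cart)
qed

lemma L2_vecI:
  fixes G :: "real^'n \<Rightarrow> real^'m"
  assumes "\<And>i. (\<lambda>x. G x $ i) \<in> L2 \<omega>"
  shows "G \<in> L2 \<omega>"
proof -
  have "G \<in> borel_measurable (lebesgue_on \<omega>)"
    using L2_measurable[OF assms]
    by (auto simp: borel_measurable_euclidean_space[of G] Basis_vec_def inner_axis)
  moreover have "integrable (lebesgue_on \<omega>) (\<lambda>x. \<Sum>i\<in>UNIV. (norm (G x $ i))\<^sup>2)"
    by (intro Bochner_Integration.integrable_sum L2_integrable_norm_squared assms)
  ultimately show ?thesis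
    by (rule L2_bounded_by) (simp only: power2_norm_eq_inner inner_vec_def order_refl eventually_True)
qed

text \<open>On a set of finite measure 1 + |f|^2 is an integrable majorant of |f|. The pointwise
  bound n \<le> 1 + n^2 comes from (n - 1/2)^2 \<ge> 0.\<close>

lemma L2_integrable:
  assumes "f \<in> L2 \<omega>" "\<omega> \<in> lmeasurable"
  shows "integrable (lebesgue_on \<omega>) f"
proof (rule Bochner_Integration.integrable_bound)
  show "integrable (lebesgue_on \<omega>) (\<lambda>x. 1 + (norm (f x))\<^sup>2)"
    using assms
    by (intro Bochner_Integration.integrable_add L2_integrable_norm_squared
        finite_measure.integrable_const finite_measure_lebesgue_on)
  have "n \<le> 1 + n\<^sup>2" for n :: real
    using zero_le_power2[of "n - 1/2"] by (simp add: power2_eq_square algebra_simps)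
  then show "AE x in lebesgue_on \<omega>. norm (f x) \<le> norm (1 + (norm (f x))\<^sup>2)"
    by (simp add: abs_of_nonneg)
qed (rule L2_measurable[OF assms(1)])

lemma norm_L2_nonneg: "0 \<le> norm_L2 \<omega> f"
  by (simp add: norm_L2_def)

text \<open>Only pointwise norms are compared, so that residuals can later be matched with errors of
  the opposite sign.\<close>

lemma norm_L2_cong:
  assumes "f \<in> L2 \<omega>" "g \<in> L2 \<omega>" "AE x in lebesgue_on \<omega>. norm (f x) = norm (g x)"
  shows "norm_L2 \<omega> f = norm_L2 \<omega> g"
proof -
  have "integral\<^sup>L (lebesgue_on \<omega>) (\<lambda>x. (norm (f x))\<^sup>2) = integral\<^sup>L (lebesgue_on \<omega>) (\<lambda>x. (norm (g x))\<^sup>2)"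
    using assms by (intro integral_cong_AE borel_measurable_integrable L2_integrable_norm_squared) auto
  then show ?thesis
    by (simp add: norm_L2_def)
qed

lemma norm_L2_eq_0_iff:
  assumes "f \<in> L2 \<omega>"
  shows "norm_L2 \<omega> f = 0 \<longleftrightarrow> (AE x in lebesgue_on \<omega>. f x = 0)"
  using integral_nonneg_eq_0_iff_AE[OF L2_integrable_norm_squared[OF assms]]
  by (simp add: norm_L2_def)

text \<open>Integrating \<open>norm_add_squared_le\<close> suffices in place of Minkowski's
  inequality. The resulting factor 2 is the source of the constant 1/2 in the efficiency
  bound.\<close>

lemma norm_L2_diff_le:
  assumes "f \<in> L2 \<omega>" "g \<in> L2 \<omega>"
  shows "norm_L2 \<omega> (\<lambda>x. f x - g x) \<le> 2 * (norm_L2 \<omega> f + norm_L2 \<omega> g)"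
proof (rule power2_le_imp_le)
  have "(norm_L2 \<omega> (\<lambda>x. f x - g x))\<^sup>2 = integral\<^sup>L (lebesgue_on \<omega>) (\<lambda>x. (norm (f x - g x))\<^sup>2)"
    by (simp add: norm_L2_def)
  also have "\<dots> \<le> integral\<^sup>L (lebesgue_on \<omega>) (\<lambda>x. 2 * (norm (f x))\<^sup>2 + 2 * (norm (g x))\<^sup>2)"
    using assms norm_add_squared_le[of "f _" "- g _"]
    by (intro integral_mono L2_integrable_norm_squared L2_diff Bochner_Integration.integrable_add
        integrable_mult_right) auto
  also have "\<dots> = 2 * (norm_L2 \<omega> f)\<^sup>2 + 2 * (norm_L2 \<omega> g)\<^sup>2"
    using assms by (simp add: norm_L2_def L2_integrable_norm_squared)
  also have "\<dots> \<le> (2 * (norm_L2 \<omega> f + norm_L2 \<omega> g))\<^sup>2"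
    using norm_L2_nonneg[of \<omega> f] norm_L2_nonneg[of \<omega> g] by (simp add: power2_eq_square algebra_simps)
  finally show "(norm_L2 \<omega> (\<lambda>x. f x - g x))\<^sup>2 \<le> (2 * (norm_L2 \<omega> f + norm_L2 \<omega> g))\<^sup>2" .
qed (simp add: norm_L2_nonneg)

section \<open>Restriction from the open domain to closed elements\<close>

lemma AE_lebesgue_on_almost_subset:
  assumes "AE x in lebesgue_on \<Omega>. P x" "\<Omega> \<in> sets lebesgue" "K \<in> sets lebesgue" "negligible (K - \<Omega>)"
  shows "AE x in lebesgue_on K. P x"
proof -
  have "AE x in lebesgue. x \<in> \<Omega> \<longrightarrow> P x"
    using assms by (simp add: AE_restrict_space_iff)
  moreover have "AE x in lebesgue. x \<notin> K - \<Omega>"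
    using assms(4) unfolding negligible_iff_null_sets by (rule AE_not_in)
  ultimately have "AE x in lebesgue. x \<in> K \<longrightarrow> P x"
    by eventually_elim auto
  then show ?thesis
    using assms by (simp add: AE_restrict_space_iff)
qed

text \<open>On K - \<Omega> the total function f may take arbitrary values, but this set is null.
  Completeness of Lebesgue measure preserves measurability, and the integrals of |f|^2 do not see
  the set.\<close>

lemma L2_almost_subset:
  assumes f: "f \<in> L2 \<Omega>" and sets: "\<Omega> \<in> sets lebesgue" "K \<in> sets lebesgue" and null: "negligible (K - \<Omega>)"
  shows "f \<in> L2 K"
proof -
  have "f \<in> borel_measurable (lebesgue_on (K \<inter> \<Omega>))"
    using L2_measurable[OF f] by (rule measurable_restrict_mono) simp
  moreover have "K - (K - \<Omega>) = K \<inter> \<Omega>"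
    by blast
  moreover have "K - \<Omega> \<in> null_sets (lebesgue_on K)"
    using null sets by (auto simp: negligible_iff_null_sets null_sets_restrict_space)
  ultimately have meas: "f \<in> borel_measurable (lebesgue_on K)"
    using borel_measurable_diff_null[of "K - \<Omega>" K f] sets by simp
  have "integrable lebesgue (\<lambda>x. indicator \<Omega> x *\<^sub>R (norm (f x))\<^sup>2)"
    using L2_integrable_norm_squared[OF f] sets by (simp add: integrable_restrict_space)
  then have "integrable lebesgue (\<lambda>x. indicator K x *\<^sub>R (norm (f x))\<^sup>2)"
  proof (rule Bochner_Integration.integrable_bound)
    have "(\<lambda>x. (norm (f x))\<^sup>2) \<in> borel_measurable (lebesgue_on K)"
      using meas by simp
    then show "(\<lambda>x. indicator K x *\<^sub>R (norm (f x))\<^sup>2) \<in> borel_measurable lebesgue"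
      using sets by (simp add: borel_measurable_restrict_space_iff)
    have "AE x in lebesgue. x \<notin> K - \<Omega>"
      using null unfolding negligible_iff_null_sets by (rule AE_not_in)
    then show "AE x in lebesgue. norm (indicator K x *\<^sub>R (norm (f x))\<^sup>2) \<le> norm (indicator \<Omega> x *\<^sub>R (norm (f x))\<^sup>2)"
      by eventually_elim (auto simp: indicator_def)
  qed
  then show ?thesis
    using meas sets by (simp add: L2_def integrable_restrict_space)
qed

section \<open>Weak gradients and the operator \<open>A : \<nabla>\<close>\<close>

text \<open>A continuous factor is bounded on the compact closure of \<Omega>. This integrability is
  what allows integrals against test functions and their partial derivatives to be split over
  differences.\<close>

lemma integrable_mult_continuous:
  fixes v :: "real^'n \<Rightarrow> real"
  assumes v: "integrable (lebesgue_on \<Omega>) v" and \<Omega>: "\<Omega> \<in> lmeasurable" "bounded \<Omega>"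
    and w: "continuous_on UNIV w"
  shows "integrable (lebesgue_on \<Omega>) (\<lambda>x. v x * w x)"
proof -
  have "bounded (w ` closure \<Omega>)"
    by (intro compact_imp_bounded compact_continuous_image continuous_on_subset[OF w])
       (auto simp: \<Omega>(2))
  then obtain M where M: "\<And>x. x \<in> \<Omega> \<Longrightarrow> \<bar>w x\<bar> \<le> M"
    unfolding bounded_iff using closure_subset by (metis imageI real_norm_def subsetD)
  have w_meas: "w \<in> borel_measurable (lebesgue_on \<Omega>)"
    using \<Omega>(1) by (intro continuous_imp_measurable_on_sets_lebesgue continuous_on_subset[OF w]) auto
  show ?thesis
  proof (rule Bochner_Integration.integrable_bound)
    show "integrable (lebesgue_on \<Omega>) (\<lambda>x. M * v x)"
      using v by simp
    show "(\<lambda>x. v x * w x) \<in> borel_measurable (lebesgue_on \<Omega>)"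
      using v w_meas by simp
    show "AE x in lebesgue_on \<Omega>. norm (v x * w x) \<le> norm (M * v x)"
    proof (rule AE_I2)
      fix x assume "x \<in> space (lebesgue_on \<Omega>)"
      then have "\<bar>w x\<bar> \<le> \<bar>M\<bar>"
        using M[of x] by simp
      then show "norm (v x * w x) \<le> norm (M * v x)"
        by (simp add: abs_mult mult.commute[of "\<bar>M\<bar>"] mult_left_mono)
    qed
  qed
qed

lemma is_weak_grad_diff:
  assumes \<Omega>: "\<Omega> \<in> lmeasurable" "bounded \<Omega>"
    and L2: "v \<in> L2 \<Omega>" "w \<in> L2 \<Omega>" "G \<in> L2 \<Omega>" "H \<in> L2 \<Omega>"
    and wg: "is_weak_grad \<Omega> v G" "is_weak_grad \<Omega> w H"
  shows "is_weak_grad \<Omega> (\<lambda>x. v x - w x) (\<lambda>x. G x - H x)"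
  unfolding is_weak_grad_def
proof (intro ballI allI)
  fix \<phi> i assume \<phi>: "\<phi> \<in> test_functions \<Omega>"
  have int: "integrable (lebesgue_on \<Omega>) (\<lambda>x. f x * \<psi> x)"
    if "f \<in> L2 \<Omega>" "continuous_on UNIV \<psi>" for f \<psi> :: "real^'a \<Rightarrow> real"
    by (intro integrable_mult_continuous L2_integrable that \<Omega>)
  note cont = test_function_continuous[OF \<phi>]
  show "integral\<^sup>L (lebesgue_on \<Omega>) (\<lambda>x. (v x - w x) * partial i \<phi> x) =
        - integral\<^sup>L (lebesgue_on \<Omega>) (\<lambda>x. (G x - H x) $ i * \<phi> x)"
    using wg \<phi> int[OF L2(1) cont(2)] int[OF L2(2) cont(2)]
      int[OF L2_vec_component[OF L2(3)] cont(1)] int[OF L2_vec_component[OF L2(4)] cont(1)]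
    by (simp add: is_weak_grad_def left_diff_distrib)
qed

text \<open>Each component of G - H integrates to zero against all test functions, so the
  fundamental lemma applies; finitely many components share one null set.\<close>

lemma is_weak_grad_unique:
  fixes \<Omega> :: "(real^'n) set"
  assumes \<Omega>: "open \<Omega>" "bounded \<Omega>"
    and L2: "G \<in> L2 \<Omega>" "H \<in> L2 \<Omega>"
    and wg: "is_weak_grad \<Omega> v G" "is_weak_grad \<Omega> v H"
  shows "eq_ae \<Omega> G H"
proof -
  have \<Omega>': "\<Omega> \<in> lmeasurable"
    using \<Omega> by (simp add: lmeasurable_open)
  have "AE x in lebesgue_on \<Omega>. G x $ i - H x $ i = 0" for i
  proof (rule fundamental_lemma_calculus_of_variations[OF \<Omega>(1)])
    have int: "integrable (lebesgue_on \<Omega>) (\<lambda>x. G x $ i)" "integrable (lebesgue_on \<Omega>) (\<lambda>x. H x $ i)"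
      by (intro L2_integrable L2_vec_component L2 \<Omega>')+
    then show "integrable (lebesgue_on \<Omega>) (\<lambda>x. G x $ i - H x $ i)"
      by simp
    fix \<phi> assume \<phi>: "\<phi> \<in> test_functions \<Omega>"
    have "integrable (lebesgue_on \<Omega>) (\<lambda>x. G x $ i * \<phi> x)" "integrable (lebesgue_on \<Omega>) (\<lambda>x. H x $ i * \<phi> x)"
      by (intro integrable_mult_continuous int \<Omega>' \<Omega> test_function_continuous(1)[OF \<phi>])+
    then show "integral\<^sup>L (lebesgue_on \<Omega>) (\<lambda>x. (G x $ i - H x $ i) * \<phi> x) = 0"
      using wg \<phi> by (simp add: is_weak_grad_def left_diff_distrib)
  qed
  then have "AE x in lebesgue_on \<Omega>. \<forall>i. G x $ i - H x $ i = 0"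
    by (simp add: AE_all_countable)
  then show ?thesis
    unfolding eq_ae_def by eventually_elim (simp add: vec_eq_iff)
qed

lemma weak_grad_H1:
  assumes "v \<in> H1 \<Omega>"
  shows "weak_grad \<Omega> v \<in> L2 \<Omega>" "is_weak_grad \<Omega> v (weak_grad \<Omega> v)"
proof -
  have "\<exists>G. G \<in> L2 \<Omega> \<and> is_weak_grad \<Omega> v G"
    using assms by (simp add: H1_def)
  from someI_ex[OF this] show "weak_grad \<Omega> v \<in> L2 \<Omega>" "is_weak_grad \<Omega> v (weak_grad \<Omega> v)"
    by (simp_all add: weak_grad_def)
qed

lemma H1_in_L2: "v \<in> H1 \<Omega> \<Longrightarrow> v \<in> L2 \<Omega>"
  by (simp add: H1_def)

text \<open>\<open>weak_grad\<close> picks a representative for each function separately, so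
  linearity can hold only almost everywhere. The difference of the two representatives is a weak
  gradient of v - w, and uniqueness identifies it with the chosen one.\<close>

lemma weak_grad_diff:
  assumes \<Omega>: "open \<Omega>" "bounded \<Omega>" and H1: "v \<in> H1 \<Omega>" "w \<in> H1 \<Omega>"
  shows "(\<lambda>x. v x - w x) \<in> H1 \<Omega>"
    and "eq_ae \<Omega> (weak_grad \<Omega> (\<lambda>x. v x - w x)) (\<lambda>x. weak_grad \<Omega> v x - weak_grad \<Omega> w x)"
proof -
  have wg: "is_weak_grad \<Omega> (\<lambda>x. v x - w x) (\<lambda>x. weak_grad \<Omega> v x - weak_grad \<Omega> w x)"
    by (rule is_weak_grad_diff[OF lmeasurable_open[OF \<Omega>(2,1)] \<Omega>(2) H1[THEN H1_in_L2]
          H1[THEN weak_grad_H1(1)] H1[THEN weak_grad_H1(2)]])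
  have L2: "(\<lambda>x. weak_grad \<Omega> v x - weak_grad \<Omega> w x) \<in> L2 \<Omega>"
    by (rule L2_diff[OF H1[THEN weak_grad_H1(1)]])
  show H: "(\<lambda>x. v x - w x) \<in> H1 \<Omega>"
    using wg L2 L2_diff[OF H1_in_L2[OF H1(1)] H1_in_L2[OF H1(2)]] unfolding H1_def by blast
  show "eq_ae \<Omega> (weak_grad \<Omega> (\<lambda>x. v x - w x)) (\<lambda>x. weak_grad \<Omega> v x - weak_grad \<Omega> w x)"
    by (rule is_weak_grad_unique[OF \<Omega> weak_grad_H1(1)[OF H] L2 weak_grad_H1(2)[OF H] wg])
qed

section \<open>The operator A : grad on Q\<close>

lemma A_grad_H1_in_L2:
  assumes "A \<in> Linf_matrix \<Omega>" "\<tau> \<in> vec_space (H1 \<Omega>)"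
  shows "A_grad_H1 \<Omega> A \<tau> \<in> L2 \<Omega>"
proof -
  have "(\<lambda>x. A x $ i $ j * weak_grad \<Omega> (\<lambda>y. \<tau> y $ i) x $ j) \<in> L2 \<Omega>" for i j
  proof -
    obtain M where "AE x in lebesgue_on \<Omega>. \<bar>A x $ i $ j\<bar> \<le> M"
      using assms(1) by (auto simp: Linf_matrix_def)
    then show ?thesis
      using assms by (intro L2_bounded_mult L2_vec_component weak_grad_H1)
        (auto simp: Linf_matrix_def vec_space_def)
  qed
  then have "(\<lambda>x. \<Sum>i\<in>UNIV. \<Sum>j\<in>UNIV. A x $ i $ j * weak_grad \<Omega> (\<lambda>y. \<tau> y $ i) x $ j) \<in> L2 \<Omega>"
    by (intro L2_sum) auto
  then show ?thesis
    by (simp add: A_grad_H1_def[abs_def])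
qed

text \<open>This makes the discretization conforming: piecewise polynomial fluxes with H1 components
  are admissible in Q.\<close>

lemma vec_space_H1_subset_Q_space:
  assumes "A_grad_reading \<Omega> A R" "A \<in> Linf_matrix \<Omega>"
  shows "vec_space (H1 \<Omega>) \<subseteq> Q_space \<Omega> R"
proof
  fix \<tau> assume \<tau>: "\<tau> \<in> vec_space (H1 \<Omega>)"
  then have "\<tau> \<in> L2 \<Omega>"
    by (intro L2_vecI) (auto simp: vec_space_def H1_in_L2)
  moreover have "R \<tau> (A_grad_H1 \<Omega> A \<tau>)"
    using assms(1) \<tau> by (simp add: A_grad_reading_def)
  ultimately show "\<tau> \<in> Q_space \<Omega> R"
    using A_grad_H1_in_L2[OF assms(2) \<tau>] by (auto simp: Q_space_def)
qed

lemma A_grad_Q_space: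
  assumes "\<tau> \<in> Q_space \<Omega> R"
  shows "A_grad \<Omega> R \<tau> \<in> L2 \<Omega>" "R \<tau> (A_grad \<Omega> R \<tau>)"
proof -
  have "\<exists>g. g \<in> L2 \<Omega> \<and> R \<tau> g"
    using assms by (auto simp: Q_space_def)
  from someI_ex[OF this] show "A_grad \<Omega> R \<tau> \<in> L2 \<Omega>" "R \<tau> (A_grad \<Omega> R \<tau>)"
    by (simp_all add: A_grad_def)
qed

lemma Q_space_in_L2: "\<tau> \<in> Q_space \<Omega> R \<Longrightarrow> \<tau> \<in> L2 \<Omega>"
  by (simp add: Q_space_def)

lemma A_grad_unique:
  assumes "A_grad_reading \<Omega> A R" "\<tau> \<in> L2 \<Omega>" "g \<in> L2 \<Omega>" "R \<tau> g"
  shows "\<tau> \<in> Q_space \<Omega> R" "eq_ae \<Omega> (A_grad \<Omega> R \<tau>) g"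
proof -
  show Q: "\<tau> \<in> Q_space \<Omega> R"
    using assms by (auto simp: Q_space_def)
  show "eq_ae \<Omega> (A_grad \<Omega> R \<tau>) g"
    using assms A_grad_Q_space[OF Q] unfolding A_grad_reading_def by blast
qed

text \<open>The chosen value for \<tau> is also a value for \<tau>' because a reading respects
  almost-everywhere classes; single-valuedness then fixes it up to null sets.\<close>

lemma A_grad_cong_ae:
  assumes reading: "A_grad_reading \<Omega> A R" and \<tau>: "\<tau> \<in> Q_space \<Omega> R" and "\<tau>' \<in> L2 \<Omega>" "eq_ae \<Omega> \<tau> \<tau>'"
  shows "\<tau>' \<in> Q_space \<Omega> R" "eq_ae \<Omega> (A_grad \<Omega> R \<tau>') (A_grad \<Omega> R \<tau>)"
proof -
  have "eq_ae \<Omega> (A_grad \<Omega> R \<tau>) (A_grad \<Omega> R \<tau>)"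
    by (simp add: eq_ae_def)
  then have "R \<tau>' (A_grad \<Omega> R \<tau>)"
    using assms A_grad_Q_space[OF \<tau>] Q_space_in_L2[OF \<tau>] unfolding A_grad_reading_def by blast
  then show "\<tau>' \<in> Q_space \<Omega> R" "eq_ae \<Omega> (A_grad \<Omega> R \<tau>') (A_grad \<Omega> R \<tau>)"
    using A_grad_unique[OF reading] assms(3) A_grad_Q_space(1)[OF \<tau>] by blast+
qed

lemma A_grad_diff:
  assumes reading: "A_grad_reading \<Omega> A R" and Q: "\<tau> \<in> Q_space \<Omega> R" "\<tau>' \<in> Q_space \<Omega> R"
  shows "(\<lambda>x. \<tau> x - \<tau>' x) \<in> Q_space \<Omega> R"
    and "eq_ae \<Omega> (A_grad \<Omega> R (\<lambda>x. \<tau> x - \<tau>' x)) (\<lambda>x. A_grad \<Omega> R \<tau> x - A_grad \<Omega> R \<tau>' x)"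
proof -
  \<comment> \<open>The linearity clause of the reading is used with coefficients 1 and -1.\<close>
  have "R (\<lambda>x. 1 *\<^sub>R \<tau> x + (- 1) *\<^sub>R \<tau>' x) (\<lambda>x. 1 * A_grad \<Omega> R \<tau> x + (- 1) * A_grad \<Omega> R \<tau>' x)"
    using reading[unfolded A_grad_reading_def, THEN conjunct2, THEN conjunct2, THEN conjunct1,
        rule_format, OF Q[THEN Q_space_in_L2] Q[THEN A_grad_Q_space(1)] Q[THEN A_grad_Q_space(2)]] .
  then have R: "R (\<lambda>x. \<tau> x - \<tau>' x) (\<lambda>x. A_grad \<Omega> R \<tau> x - A_grad \<Omega> R \<tau>' x)"
    by simp
  have L2: "(\<lambda>x. \<tau> x - \<tau>' x) \<in> L2 \<Omega>" "(\<lambda>x. A_grad \<Omega> R \<tau> x - A_grad \<Omega> R \<tau>' x) \<in> L2 \<Omega>"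
    by (rule L2_diff[OF Q[THEN Q_space_in_L2]], rule L2_diff[OF Q[THEN A_grad_Q_space(1)]])
  show "(\<lambda>x. \<tau> x - \<tau>' x) \<in> Q_space \<Omega> R"
    "eq_ae \<Omega> (A_grad \<Omega> R (\<lambda>x. \<tau> x - \<tau>' x)) (\<lambda>x. A_grad \<Omega> R \<tau> x - A_grad \<Omega> R \<tau>' x)"
    by (rule A_grad_unique[OF reading, OF L2 R])+
qed

section \<open>Meshes and the least-squares functional\<close>

lemma bounded_open_polytopeD:
  assumes "bounded_open_polytope \<Omega>"
  shows "open \<Omega>" "bounded \<Omega>" "negligible (closure \<Omega> - \<Omega>)"
proof -
  obtain \<P> where \<P>: "finite \<P>" "\<forall>P\<in>\<P>. polytope P" "\<Omega> = interior (\<Union>\<P>)"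
    using assms by (auto simp: bounded_open_polytope_def)
  show "open \<Omega>"
    by (simp add: \<P>(3))
  have "bounded (\<Union>\<P>)"
    using \<P> by (auto simp: polytope_imp_bounded)
  then show "bounded \<Omega>"
    using \<P>(3) bounded_subset interior_subset by blast
  have "closed (\<Union>\<P>)"
    using \<P> by (intro closed_Union) (auto simp: polytope_imp_closed)
  \<comment> \<open>The boundary of a finite union lies in the union of the boundaries, and each of
    these is null by convexity of the pieces.\<close>
  then have "closure \<Omega> - \<Omega> \<subseteq> frontier (\<Union>\<P>)"
    using \<P>(3) closure_minimal[OF interior_subset] by (auto simp: frontier_def)
  also have "\<dots> \<subseteq> (\<Union>P\<in>\<P>. frontier P)"
    using frontier_Union_subset[OF \<P>(1)] by (auto)
  finally have "closure \<Omega> - \<Omega> \<subseteq> (\<Union>P\<in>\<P>. frontier P)" .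
  moreover have "negligible (\<Union>P\<in>\<P>. frontier P)"
    using \<P> by (intro negligible_Union) (auto intro: negligible_convex_frontier polytope_imp_convex)
  ultimately show "negligible (closure \<Omega> - \<Omega>)"
    by (rule negligible_subset[rotated])
qed

lemma shape_regular_meshD:
  assumes "bounded_open_polytope \<Omega>" "shape_regular_mesh \<Omega> \<kappa> \<T>"
  shows "finite \<T>" and "\<Omega> \<subseteq> \<Union>\<T>"
    and "K \<in> \<T> \<Longrightarrow> K \<in> sets lebesgue" and "K \<in> \<T> \<Longrightarrow> negligible (K - \<Omega>)"
    and "K \<in> \<T> \<Longrightarrow> 0 < diameter K"
proof -
  show "finite \<T>"
    using assms(2) by (simp add: shape_regular_mesh_def triangulation_def)
  have cover: "\<Union>\<T> = closure \<Omega>"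
    using assms(2) by (simp add: shape_regular_mesh_def)
  then show "\<Omega> \<subseteq> \<Union>\<T>"
    using closure_subset by simp
  show "negligible (K - \<Omega>)" if "K \<in> \<T>"
    using that cover by (intro negligible_subset[OF bounded_open_polytopeD(3)[OF assms(1)]]) auto
  have simplex: "int CARD('a) simplex K" if "K \<in> \<T>"
    using assms(2) that by (simp add: shape_regular_mesh_def)
  show "K \<in> sets lebesgue" if "K \<in> \<T>"
    using compact_simplex[OF simplex[OF that]] by (simp add: lmeasurable_compact fmeasurableD)
  show "0 < diameter K" if K: "K \<in> \<T>"
  proof -
    \<comment> \<open>Positive affine dimension excludes the empty set and singletons, whose affine
      dimensions are -1 and 0. Two distinct points make the diameter positive.\<close>
    have "aff_dim K = int CARD('a)"
      using aff_dim_simplex simplex[OF K] by blast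
    then have "K \<noteq> {}" "\<not> (\<exists>a. K = {a})"
      by auto
    then obtain x y where "x \<in> K" "y \<in> K" "x \<noteq> y"
      by blast
    moreover have "bounded K"
      using compact_simplex[OF simplex[OF K]] compact_imp_bounded by blast
    ultimately show ?thesis
      using diameter_bounded_bound[of K x y] zero_less_dist_iff[of x y] by linarith
  qed
qed

section \<open>Zeros and minimizers of the least-squares functional\<close>

lemma LS_functional_nonneg: "0 \<le> LS_functional \<Omega> R \<T> f p"
  by (auto simp: LS_functional_def split: prod.split intro!: add_nonneg_nonneg sum_nonneg)

text \<open>A sum of nonnegative terms vanishes only termwise, and the weights h_K^2 are positive.
  The elementwise equations glue to one on \<Omega> since finitely many elements cover it;
  conversely, elements leave \<Omega> only on null sets.\<close>

lemma LS_functional_eq_0_iff: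
  assumes dom: "bounded_open_polytope \<Omega>" and mesh: "shape_regular_mesh \<Omega> \<kappa> \<T>"
    and f: "f \<in> L2 \<Omega>" and v: "v \<in> H1 \<Omega>" and \<tau>: "\<tau> \<in> Q_space \<Omega> R"
  shows "LS_functional \<Omega> R \<T> f (v, \<tau>) = 0 \<longleftrightarrow>
    eq_ae \<Omega> (\<lambda>x. - A_grad \<Omega> R \<tau> x) f \<and> eq_ae \<Omega> \<tau> (weak_grad \<Omega> v)"
proof -
  note mesh = shape_regular_meshD[OF dom mesh]
  have \<Omega>: "\<Omega> \<in> sets lebesgue"
    using bounded_open_polytopeD(1)[OF dom] by (simp add: borel_open)
  have res: "(\<lambda>x. f x + A_grad \<Omega> R \<tau> x) \<in> L2 \<Omega>"
    by (rule L2_add[OF f A_grad_Q_space(1)[OF \<tau>]])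
  have "LS_functional \<Omega> R \<T> f (v, \<tau>) = 0 \<longleftrightarrow>
    (\<forall>K\<in>\<T>. norm_L2 K (\<lambda>x. f x + A_grad \<Omega> R \<tau> x) = 0) \<and>
    norm_L2 \<Omega> (\<lambda>x. \<tau> x - weak_grad \<Omega> v x) = 0"
    using mesh(1) less_imp_neq[OF mesh(5), symmetric]
    by (simp add: LS_functional_def add_nonneg_eq_0_iff sum_nonneg sum_nonneg_eq_0_iff)
  also have "norm_L2 \<Omega> (\<lambda>x. \<tau> x - weak_grad \<Omega> v x) = 0 \<longleftrightarrow> eq_ae \<Omega> \<tau> (weak_grad \<Omega> v)"
    using norm_L2_eq_0_iff[OF L2_diff[OF Q_space_in_L2[OF \<tau>] weak_grad_H1(1)[OF v]]]
    by (simp add: eq_ae_def)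
  also have "(\<forall>K\<in>\<T>. norm_L2 K (\<lambda>x. f x + A_grad \<Omega> R \<tau> x) = 0) \<longleftrightarrow>
    (\<forall>K\<in>\<T>. AE x in lebesgue_on K. f x + A_grad \<Omega> R \<tau> x = 0)"
    using norm_L2_eq_0_iff[OF L2_almost_subset[OF res \<Omega> mesh(3,4)]] by blast
  also have "\<dots> \<longleftrightarrow> (AE x in lebesgue_on \<Omega>. f x + A_grad \<Omega> R \<tau> x = 0)"
  proof
    assume "\<forall>K\<in>\<T>. AE x in lebesgue_on K. f x + A_grad \<Omega> R \<tau> x = 0"
    then have "\<forall>K\<in>\<T>. AE x in lebesgue. x \<in> K \<longrightarrow> f x + A_grad \<Omega> R \<tau> x = 0"
      using mesh(3) by (simp add: AE_restrict_space_iff)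
    then have "AE x in lebesgue. \<forall>K\<in>\<T>. x \<in> K \<longrightarrow> f x + A_grad \<Omega> R \<tau> x = 0"
      unfolding AE_finite_all[OF mesh(1)] .
    then have "AE x in lebesgue. x \<in> \<Omega> \<longrightarrow> f x + A_grad \<Omega> R \<tau> x = 0"
      by (rule eventually_mono) (use mesh(2) in blast)
    then show "AE x in lebesgue_on \<Omega>. f x + A_grad \<Omega> R \<tau> x = 0"
      using \<Omega> by (simp add: AE_restrict_space_iff)
  next
    assume zero: "AE x in lebesgue_on \<Omega>. f x + A_grad \<Omega> R \<tau> x = 0"
    show "\<forall>K\<in>\<T>. AE x in lebesgue_on K. f x + A_grad \<Omega> R \<tau> x = 0"
      using AE_lebesgue_on_almost_subset[OF zero \<Omega> mesh(3,4)] by blast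
  qed
  also have "\<dots> \<longleftrightarrow> eq_ae \<Omega> (\<lambda>x. - A_grad \<Omega> R \<tau> x) f"
    unfolding eq_ae_def by (intro eventually_subst always_eventually) auto
  finally show ?thesis
    by blast
qed

lemma H1_0_in_H1: "v \<in> H1_0 \<Omega> \<Longrightarrow> v \<in> H1 \<Omega>"
  by (simp add: H1_0_def)

lemma solves_LS_functional_eq_0:
  assumes "bounded_open_polytope \<Omega>" "shape_regular_mesh \<Omega> \<kappa> \<T>" "f \<in> L2 \<Omega>" "solves \<Omega> R f v"
  shows "weak_grad \<Omega> v \<in> Q_space \<Omega> R" "LS_functional \<Omega> R \<T> f (v, weak_grad \<Omega> v) = 0"
proof -
  have v: "v \<in> H1 \<Omega>"
    using assms(4) by (simp add: solves_def V_space_def H1_0_in_H1)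
  show Q: "weak_grad \<Omega> v \<in> Q_space \<Omega> R"
    using assms(4) weak_grad_H1(1)[OF v] by (simp add: solves_def V_space_def Q_space_def)
  show "LS_functional \<Omega> R \<T> f (v, weak_grad \<Omega> v) = 0"
    using assms(4) unfolding LS_functional_eq_0_iff[OF assms(1,2,3) v Q]
    by (simp add: solves_def A_hess_def eq_ae_def)
qed

lemma LS_minimizer:
  assumes dom: "bounded_open_polytope \<Omega>" and mesh: "shape_regular_mesh \<Omega> \<kappa> \<T>"
    and reading: "A_grad_reading \<Omega> A R" and solv: "uniquely_solvable \<Omega> R" and f: "f \<in> L2 \<Omega>"
    and min: "is_arg_min (LS_functional \<Omega> R \<T> f) (\<lambda>p. p \<in> H1_0 \<Omega> \<times> Q_space \<Omega> R) (u, \<sigma>)"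
  shows "eq_ae \<Omega> (\<lambda>x. - A_grad \<Omega> R \<sigma> x) f" "eq_ae \<Omega> \<sigma> (weak_grad \<Omega> u)" "solves \<Omega> R f u"
proof -
  have u: "u \<in> H1_0 \<Omega>" "u \<in> H1 \<Omega>" and \<sigma>: "\<sigma> \<in> Q_space \<Omega> R"
    using min by (auto simp: is_arg_min_def H1_0_in_H1)
  obtain v where v: "solves \<Omega> R f v"
    using solv f unfolding uniquely_solvable_def by blast
  have "(v, weak_grad \<Omega> v) \<in> H1_0 \<Omega> \<times> Q_space \<Omega> R"
    using v solves_LS_functional_eq_0(1)[OF dom mesh f v] by (simp add: solves_def V_space_def)
  then have "LS_functional \<Omega> R \<T> f (u, \<sigma>) \<le> LS_functional \<Omega> R \<T> f (v, weak_grad \<Omega> v)"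
    using min unfolding is_arg_min_def by (meson not_le)
  then have "LS_functional \<Omega> R \<T> f (u, \<sigma>) = 0"
    using solves_LS_functional_eq_0(2)[OF dom mesh f v] LS_functional_nonneg[of \<Omega> R \<T> f "(u, \<sigma>)"] by simp
  then show res: "eq_ae \<Omega> (\<lambda>x. - A_grad \<Omega> R \<sigma> x) f" and grad: "eq_ae \<Omega> \<sigma> (weak_grad \<Omega> u)"
    using LS_functional_eq_0_iff[OF dom mesh f u(2) \<sigma>] by blast+
  \<comment> \<open>The equation is known for \<sigma>, whereas \<open>solves\<close> speaks of
    \<open>weak_grad \<Omega> u\<close>. Their equality almost everywhere transfers both membership
    and value of the operator.\<close>
  note * = A_grad_cong_ae[OF reading \<sigma> weak_grad_H1(1)[OF u(2)] grad]
  then have "u \<in> V_space \<Omega> R"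
    using u(1) by (simp add: V_space_def Q_space_def)
  moreover have "eq_ae \<Omega> (\<lambda>x. - A_hess \<Omega> R u x) f"
    using res *(2) unfolding eq_ae_def A_hess_def by eventually_elim simp
  ultimately show "solves \<Omega> R f u"
    by (simp add: solves_def)
qed

section \<open>The error indicator and the local error norm\<close>

lemma eta_K_eq_energy_norm_K:
  assumes dom: "bounded_open_polytope \<Omega>" and mesh: "shape_regular_mesh \<Omega> \<kappa> \<T>" and K: "K \<in> \<T>"
    and reading: "A_grad_reading \<Omega> A R" and f: "f \<in> L2 \<Omega>"
    and H1: "u \<in> H1 \<Omega>" "w \<in> H1 \<Omega>" and Q: "\<sigma> \<in> Q_space \<Omega> R" "\<tau> \<in> Q_space \<Omega> R"
    and exact: "eq_ae \<Omega> (\<lambda>x. - A_grad \<Omega> R \<sigma> x) f" "eq_ae \<Omega> \<sigma> (weak_grad \<Omega> u)"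
  shows "eta_K \<Omega> R K f w \<tau> = energy_norm_K \<Omega> R K (\<lambda>x. u x - w x) (\<lambda>x. \<sigma> x - \<tau> x)"
proof -
  note \<Omega> = bounded_open_polytopeD(1,2)[OF dom]
  note K = shape_regular_meshD(3,4)[OF dom mesh K]
  have sets: "\<Omega> \<in> sets lebesgue"
    using \<Omega> by (simp add: borel_open)
  note restrict_L2 = L2_almost_subset[OF _ sets K]
  note restrict_ae = AE_lebesgue_on_almost_subset[OF _ sets K]
  note diff = weak_grad_diff[OF \<Omega> H1] A_grad_diff[OF reading Q]
  \<comment> \<open>Since f = - A : grad \<sigma>, the residual is - A : grad (\<sigma> - \<tau>)
    almost everywhere.\<close>
  have "norm_L2 K (\<lambda>x. f x + A_grad \<Omega> R \<tau> x) = norm_L2 K (A_grad \<Omega> R (\<lambda>x. \<sigma> x - \<tau> x))"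
  proof (rule norm_L2_cong)
    show "AE x in lebesgue_on K. norm (f x + A_grad \<Omega> R \<tau> x) = norm (A_grad \<Omega> R (\<lambda>x. \<sigma> x - \<tau> x) x)"
      using restrict_ae[OF exact(1)[unfolded eq_ae_def]] restrict_ae[OF diff(4)[unfolded eq_ae_def]]
      by eventually_elim auto
    show "(\<lambda>x. f x + A_grad \<Omega> R \<tau> x) \<in> L2 K"
      by (rule restrict_L2[OF L2_add[OF f A_grad_Q_space(1)[OF Q(2)]]])
    show "A_grad \<Omega> R (\<lambda>x. \<sigma> x - \<tau> x) \<in> L2 K"
      by (rule restrict_L2[OF A_grad_Q_space(1)[OF diff(3)]])
  qed
  \<comment> \<open>Subtracting \<sigma> - grad u = 0 shows that the two integrands are negatives of
    each other.\<close>
  moreover have "norm_L2 K (\<lambda>x. \<tau> x - weak_grad \<Omega> w x) =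
      norm_L2 K (\<lambda>x. (\<sigma> x - \<tau> x) - weak_grad \<Omega> (\<lambda>x. u x - w x) x)"
  proof (rule norm_L2_cong)
    show "AE x in lebesgue_on K. norm (\<tau> x - weak_grad \<Omega> w x) =
        norm ((\<sigma> x - \<tau> x) - weak_grad \<Omega> (\<lambda>x. u x - w x) x)"
      using restrict_ae[OF exact(2)[unfolded eq_ae_def]] restrict_ae[OF diff(2)[unfolded eq_ae_def]]
      by eventually_elim (simp add: norm_minus_commute)
    show "(\<lambda>x. \<tau> x - weak_grad \<Omega> w x) \<in> L2 K"
      by (rule restrict_L2[OF L2_diff[OF Q_space_in_L2[OF Q(2)] weak_grad_H1(1)[OF H1(2)]]])
    show "(\<lambda>x. (\<sigma> x - \<tau> x) - weak_grad \<Omega> (\<lambda>x. u x - w x) x) \<in> L2 K"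
      by (rule restrict_L2[OF L2_diff[OF Q_space_in_L2[OF diff(3)] weak_grad_H1(1)[OF diff(1)]]])
  qed
  ultimately show ?thesis
    by (simp add: eta_K_def energy_norm_K_def)
qed

text \<open>First sqrt (a^2 + b^2) \<le> a + b separates the two terms, then
  \<open>norm_L2_diff_le\<close> splits the second at the cost of a factor 2. Halving absorbs this
  factor and only shrinks the first, nonnegative term.\<close>

lemma energy_norm_K_le:
  assumes L2: "\<tau> \<in> L2 K" "weak_grad \<Omega> v \<in> L2 K" and K: "0 \<le> diameter K"
  shows "1 / 2 * energy_norm_K \<Omega> R K v \<tau>
    \<le> diameter K * norm_L2 K (A_grad \<Omega> R \<tau>) + norm_L2 K \<tau> + norm_L2 K (weak_grad \<Omega> v)"
proof -
  have pos: "0 \<le> diameter K * norm_L2 K (A_grad \<Omega> R \<tau>)"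
    using K by (simp add: norm_L2_nonneg)
  have "energy_norm_K \<Omega> R K v \<tau>
      \<le> diameter K * norm_L2 K (A_grad \<Omega> R \<tau>) + norm_L2 K (\<lambda>x. \<tau> x - weak_grad \<Omega> v x)"
    using sqrt_sum_squares_le_sum[OF pos norm_L2_nonneg[of K "\<lambda>x. \<tau> x - weak_grad \<Omega> v x"]]
    by (simp add: energy_norm_K_def power_mult_distrib)
  then show ?thesis
    using norm_L2_diff_le[OF L2] pos
    by simp
qed

theorem theorem3p7:
  fixes \<Omega> :: "(real^'n) set"
    and A :: "real^'n \<Rightarrow> real^'n^'n"
    and R :: "(real^'n \<Rightarrow> real^'n) \<Rightarrow> (real^'n \<Rightarrow> real) \<Rightarrow> bool"
    and k :: nat and \<kappa> :: real
  assumes "CARD('n) = 2 \<or> CARD('n) = 3"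
    and "bounded_open_polytope \<Omega>"
    and "A \<in> Linf_matrix \<Omega>"
    and "A_grad_reading \<Omega> A R"
    and "uniquely_solvable \<Omega> R"
    and "k \<ge> 2"
  shows "\<exists>C>0. \<forall>\<T> f u \<sigma> u\<^sub>h \<sigma>\<^sub>h.
     shape_regular_mesh \<Omega> \<kappa> \<T> \<and> f \<in> L2 \<Omega> \<and>
     is_arg_min (LS_functional \<Omega> R \<T> f) (\<lambda>p. p \<in> H1_0 \<Omega> \<times> Q_space \<Omega> R) (u, \<sigma>) \<and>
     is_arg_min (LS_functional \<Omega> R \<T> f)
       (\<lambda>p. p \<in> S0_space \<Omega> \<T> k \<times> vec_space (S_space \<Omega> \<T> (k - 1))) (u\<^sub>h, \<sigma>\<^sub>h) \<longrightarrow>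
     (solves \<Omega> R f u \<and> eq_ae \<Omega> \<sigma> (weak_grad \<Omega> u)) \<and>
     eta \<Omega> R \<T> f u\<^sub>h \<sigma>\<^sub>h = energy_norm \<Omega> R \<T> (\<lambda>x. u x - u\<^sub>h x) (\<lambda>x. \<sigma> x - \<sigma>\<^sub>h x) \<and>
     (\<forall>K\<in>\<T>. eta_K \<Omega> R K f u\<^sub>h \<sigma>\<^sub>h
              = energy_norm_K \<Omega> R K (\<lambda>x. u x - u\<^sub>h x) (\<lambda>x. \<sigma> x - \<sigma>\<^sub>h x)) \<and>
     (\<forall>K\<in>\<T>. C * eta_K \<Omega> R K f u\<^sub>h \<sigma>\<^sub>h
              \<le> diameter K * norm_L2 K (A_grad \<Omega> R (\<lambda>x. \<sigma> x - \<sigma>\<^sub>h x))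
                + norm_L2 K (\<lambda>x. \<sigma> x - \<sigma>\<^sub>h x)
                + norm_L2 K (weak_grad \<Omega> (\<lambda>x. u x - u\<^sub>h x)))"
\<comment> \<open>The constant is fixed before the mesh, the data and the minimizers are introduced,
  which expresses its independence of the mesh size.\<close>
proof (intro exI[of _ "1 / 2"] conjI allI impI)
  fix \<T> f u \<sigma> u\<^sub>h \<sigma>\<^sub>h
  assume asm: "shape_regular_mesh \<Omega> \<kappa> \<T> \<and> f \<in> L2 \<Omega> \<and>
     is_arg_min (LS_functional \<Omega> R \<T> f) (\<lambda>p. p \<in> H1_0 \<Omega> \<times> Q_space \<Omega> R) (u, \<sigma>) \<and>
     is_arg_min (LS_functional \<Omega> R \<T> f)
       (\<lambda>p. p \<in> S0_space \<Omega> \<T> k \<times> vec_space (S_space \<Omega> \<T> (k - 1))) (u\<^sub>h, \<sigma>\<^sub>h)"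
  then have mesh: "shape_regular_mesh \<Omega> \<kappa> \<T>" and f: "f \<in> L2 \<Omega>"
    and min: "is_arg_min (LS_functional \<Omega> R \<T> f) (\<lambda>p. p \<in> H1_0 \<Omega> \<times> Q_space \<Omega> R) (u, \<sigma>)"
    by auto
  note exact = LS_minimizer[OF assms(2) mesh assms(4,5) f min]
  have "\<sigma>\<^sub>h \<in> vec_space (H1 \<Omega>)"
    using asm by (auto simp: is_arg_min_def vec_space_def S_space_def)
  then have Q: "\<sigma> \<in> Q_space \<Omega> R" "\<sigma>\<^sub>h \<in> Q_space \<Omega> R"
    using asm vec_space_H1_subset_Q_space[OF assms(4,3)] by (auto simp: is_arg_min_def)
  have H1: "u \<in> H1 \<Omega>" "u\<^sub>h \<in> H1 \<Omega>"
    using asm by (auto simp: is_arg_min_def S0_space_def H1_0_in_H1)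
  show "solves \<Omega> R f u" "eq_ae \<Omega> \<sigma> (weak_grad \<Omega> u)"
    using exact by blast+
  have eq: "eta_K \<Omega> R K f u\<^sub>h \<sigma>\<^sub>h = energy_norm_K \<Omega> R K (\<lambda>x. u x - u\<^sub>h x) (\<lambda>x. \<sigma> x - \<sigma>\<^sub>h x)"
    if "K \<in> \<T>" for K
    by (rule eta_K_eq_energy_norm_K[OF assms(2) mesh that assms(4) f H1 Q exact(1,2)])
  then show "\<forall>K\<in>\<T>. eta_K \<Omega> R K f u\<^sub>h \<sigma>\<^sub>h
              = energy_norm_K \<Omega> R K (\<lambda>x. u x - u\<^sub>h x) (\<lambda>x. \<sigma> x - \<sigma>\<^sub>h x)"
    by blast
  from eq show "eta \<Omega> R \<T> f u\<^sub>h \<sigma>\<^sub>h = energy_norm \<Omega> R \<T> (\<lambda>x. u x - u\<^sub>h x) (\<lambda>x. \<sigma> x - \<sigma>\<^sub>h x)"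
    by (simp add: eta_def energy_norm_def)
  show "\<forall>K\<in>\<T>. 1 / 2 * eta_K \<Omega> R K f u\<^sub>h \<sigma>\<^sub>h
              \<le> diameter K * norm_L2 K (A_grad \<Omega> R (\<lambda>x. \<sigma> x - \<sigma>\<^sub>h x))
                + norm_L2 K (\<lambda>x. \<sigma> x - \<sigma>\<^sub>h x)
                + norm_L2 K (weak_grad \<Omega> (\<lambda>x. u x - u\<^sub>h x))"
  proof
    fix K assume K: "K \<in> \<T>"
    note \<Omega> = bounded_open_polytopeD(1,2)[OF assms(2)]
    note meshK = shape_regular_meshD(3-5)[OF assms(2) mesh K]
    have "\<Omega> \<in> sets lebesgue"
      using \<Omega> by (simp add: borel_open)
    note restrict_L2 = L2_almost_subset[OF _ this meshK(1,2)]
    have "(\<lambda>x. \<sigma> x - \<sigma>\<^sub>h x) \<in> L2 K"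
      by (rule restrict_L2[OF L2_diff[OF Q[THEN Q_space_in_L2]]])
    moreover have "weak_grad \<Omega> (\<lambda>x. u x - u\<^sub>h x) \<in> L2 K"
      by (rule restrict_L2[OF weak_grad_H1(1)[OF weak_grad_diff(1)[OF \<Omega> H1]]])
    ultimately show "1 / 2 * eta_K \<Omega> R K f u\<^sub>h \<sigma>\<^sub>h
              \<le> diameter K * norm_L2 K (A_grad \<Omega> R (\<lambda>x. \<sigma> x - \<sigma>\<^sub>h x))
                + norm_L2 K (\<lambda>x. \<sigma> x - \<sigma>\<^sub>h x)
                + norm_L2 K (weak_grad \<Omega> (\<lambda>x. u x - u\<^sub>h x))"
      \<comment> \<open>Once the indicator is replaced by the error norm, efficiency is the
        splitting of that norm applied to the errors themselves.\<close>
      unfolding eq[OF K] using meshK(3) by (intro energy_norm_K_le) auto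
  qed
qed simp

end
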